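(* Let $G$ and $H$ be finite connected multigraphs with $H$ transitive and $G\succcurlyeq H$. Then $$\tau(G)^{1/|G|}\ge \tau(H)^{1/|H|}.$$
   Context: $\tau(K)$ is the number of spanning trees of a finite connected multigraph $K$; $|K|$ is its number of vertices. A graph is transitive if its automorphism group acts transitively on vertices. $G\succcurlyeq H$ ($G$ dominates $H$) means there is a probability measure on pairs $(X,Y)\in V(G)\times V(H)$ whose two marginals are uniform on $V(G)$ and on $V(H)$ respectively, such that almost surely there is an isomorphism from $H$ onto a subgraph of $G$ carrying $Y$ to $X$. *)

theory Defs
  imports "HOL-Probability.Probability_Mass_Function"
begin

text \<open>A finite multigraph is given by a vertex set V, an edge set E and an
  incidence map ends assigning to each edge its set of endpoints (one endpoint
  for a loop, two for an ordinary edge). Parallel edges are allowed.\<close>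

definition multigraph :: "'a set \<Rightarrow> 'e set \<Rightarrow> ('e \<Rightarrow> 'a set) \<Rightarrow> bool" where
  "multigraph V E ends \<longleftrightarrow> finite V \<and> finite E \<and>
     (\<forall>e\<in>E. ends e \<subseteq> V \<and> (card (ends e) = 1 \<or> card (ends e) = 2))"

text \<open>One-step adjacency using edges from F.\<close>
definition adj_via :: "'e set \<Rightarrow> ('e \<Rightarrow> 'a set) \<Rightarrow> ('a \<times> 'a) set" where
  "adj_via F ends = {(x, y). \<exists>e\<in>F. ends e = {x, y}}"

definition connected_via :: "'a set \<Rightarrow> 'e set \<Rightarrow> ('e \<Rightarrow> 'a set) \<Rightarrow> bool" where
  "connected_via V F ends \<longleftrightarrow> V \<noteq> {} \<and> (\<forall>x\<in>V. \<forall>y\<in>V. (x, y) \<in> (adj_via F ends)\<^sup>*)"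

definition connected_multigraph :: "'a set \<Rightarrow> 'e set \<Rightarrow> ('e \<Rightarrow> 'a set) \<Rightarrow> bool" where
  "connected_multigraph V E ends \<longleftrightarrow> multigraph V E ends \<and> connected_via V E ends"

text \<open>An edge set is acyclic if no edge lies on a cycle, i.e. for no edge e the
  endpoints of e are joined by a walk using the other edges (loops are cycles).\<close>
definition acyclic_edges :: "'e set \<Rightarrow> ('e \<Rightarrow> 'a set) \<Rightarrow> bool" where
  "acyclic_edges F ends \<longleftrightarrow>
     (\<forall>e\<in>F. card (ends e) = 2 \<and>
        (\<forall>x y. ends e = {x, y} \<longrightarrow> (x, y) \<notin> (adj_via (F - {e}) ends)\<^sup>*))"

text \<open>A spanning tree: a set of edges T of the multigraph such that (V, T) is
  connected and acyclic.\<close>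
definition spanning_tree :: "'a set \<Rightarrow> 'e set \<Rightarrow> ('e \<Rightarrow> 'a set) \<Rightarrow> 'e set \<Rightarrow> bool" where
  "spanning_tree V E ends T \<longleftrightarrow> T \<subseteq> E \<and> connected_via V T ends \<and> acyclic_edges T ends"

definition num_spanning_trees :: "'a set \<Rightarrow> 'e set \<Rightarrow> ('e \<Rightarrow> 'a set) \<Rightarrow> nat" where
  "num_spanning_trees V E ends = card {T. spanning_tree V E ends T}"

text \<open>Automorphisms: a vertex bijection and an edge bijection compatible with incidence.\<close>
definition automorphism :: "'a set \<Rightarrow> 'e set \<Rightarrow> ('e \<Rightarrow> 'a set) \<Rightarrow> ('a \<Rightarrow> 'a) \<Rightarrow> ('e \<Rightarrow> 'e) \<Rightarrow> bool" where
  "automorphism V E ends \<sigma> \<pi> \<longleftrightarrow> bij_betw \<sigma> V V \<and> bij_betw \<pi> E E \<and>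
     (\<forall>e\<in>E. ends (\<pi> e) = \<sigma> ` ends e)"

definition vertex_transitive :: "'a set \<Rightarrow> 'e set \<Rightarrow> ('e \<Rightarrow> 'a set) \<Rightarrow> bool" where
  "vertex_transitive V E ends \<longleftrightarrow>
     (\<forall>x\<in>V. \<forall>y\<in>V. \<exists>\<sigma> \<pi>. automorphism V E ends \<sigma> \<pi> \<and> \<sigma> x = y)"

text \<open>An isomorphism of H onto a subgraph of G, i.e. an injective vertex map f and
  an injective edge map g into G compatible with incidence.\<close>
definition embedding ::
  "'b set \<Rightarrow> 'f set \<Rightarrow> ('f \<Rightarrow> 'b set) \<Rightarrow> 'a set \<Rightarrow> 'e set \<Rightarrow> ('e \<Rightarrow> 'a set)
     \<Rightarrow> ('b \<Rightarrow> 'a) \<Rightarrow> ('f \<Rightarrow> 'e) \<Rightarrow> bool" where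
  "embedding VH EH endsH VG EG endsG f g \<longleftrightarrow>
     inj_on f VH \<and> f ` VH \<subseteq> VG \<and> inj_on g EH \<and> g ` EH \<subseteq> EG \<and>
     (\<forall>e\<in>EH. endsG (g e) = f ` endsH e)"

text \<open>G dominates H.  Since the vertex sets are finite, a probability measure on
  V(G) x V(H) is a pmf; "almost surely" means on its support.\<close>
definition dominates ::
  "'a set \<Rightarrow> 'e set \<Rightarrow> ('e \<Rightarrow> 'a set) \<Rightarrow> 'b set \<Rightarrow> 'f set \<Rightarrow> ('f \<Rightarrow> 'b set) \<Rightarrow> bool" where
  "dominates VG EG endsG VH EH endsH \<longleftrightarrow>
     (\<exists>p :: ('a \<times> 'b) pmf.
        map_pmf fst p = pmf_of_set VG \<and> map_pmf snd p = pmf_of_set VH \<and>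
        (\<forall>(x, y)\<in>set_pmf p. \<exists>f g. embedding VH EH endsH VG EG endsG f g \<and> f y = x))"

end

theory Submission
  imports Defs
begin

text \<open>For a set \<open>A\<close> of vertices let \<open>N A\<close> (\<open>nforests\<close> below) count the forests on \<open>A\<close> rooted outside \<open>A\<close>, that is, the
  choices of one outgoing edge at each vertex of \<open>A\<close> such that following them always leaves \<open>A\<close>;
  thus \<open>N (V - {z}) = \<tau>\<close>. The probability that a random such forest leads from \<open>u\<close> to a given
  root is harmonic in \<open>u \<in> A\<close>, and the maximum principle yields the submodularity
  \<open>N (A \<union> B) N (A \<inter> B) \<le> N A N B\<close>. For transitive \<open>H\<close>, translating an extremal set then gives
  \<open>N A \<ge> \<tau>(H)\<close> to the power \<open>|A| / |H|\<close> for every proper subset \<open>A\<close>. Domination enters only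
  through the fact that every vertex of \<open>G\<close> lies in a copy of \<open>H\<close>: a tree of \<open>G\<close> is grown by
  repeatedly attaching a copy of \<open>H\<close> that contains a vertex next to the part \<open>U\<close> covered so far, and
  the vertices of the copy outside \<open>U\<close> contribute at least the required factor.\<close>

section \<open>Rooted forests as choice functions: paths, roots, adding and removing one
  vertex\<close>

definition step :: "('v \<Rightarrow> 'e \<Rightarrow> 'v) \<Rightarrow> 'v set \<Rightarrow> ('v \<Rightarrow> 'e) \<Rightarrow> ('v \<times> 'v) set" where
  "step h A \<phi> = {(v, h v (\<phi> v)) | v. v \<in> A}"

text \<open>\<open>D v\<close> lists the edges available at \<open>v\<close>, and
  \<open>h v e\<close> is the far end of \<open>e\<close>. There is no ambient vertex set: with
  \<open>S = -A\<close> every vertex outside \<open>A\<close> may serve as a root.\<close>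

definition forests ::
  "('v \<Rightarrow> 'e set) \<Rightarrow> ('v \<Rightarrow> 'e \<Rightarrow> 'v) \<Rightarrow> 'v set \<Rightarrow> 'v set \<Rightarrow> ('v \<Rightarrow> 'e) set" where
  "forests D h A S = {\<phi> \<in> PiE A D. \<forall>v\<in>A. \<exists>r\<in>S. (v, r) \<in> (step h A \<phi>)\<^sup>*}"

definition sink :: "('v \<Rightarrow> 'e \<Rightarrow> 'v) \<Rightarrow> 'v set \<Rightarrow> ('v \<Rightarrow> 'e) \<Rightarrow> 'v \<Rightarrow> 'v" where
  "sink h A \<phi> u = (THE r. r \<notin> A \<and> (u, r) \<in> (step h A \<phi>)\<^sup>*)"

lemma step_iff: "(u, w) \<in> step h A \<phi> \<longleftrightarrow> u \<in> A \<and> w = h u (\<phi> u)"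
  by (auto simp: step_def)

lemma step_mono: "A \<subseteq> B \<Longrightarrow> (\<And>v. v \<in> A \<Longrightarrow> \<phi> v = \<psi> v) \<Longrightarrow> step h A \<phi> \<subseteq> step h B \<psi>"
  by (auto simp: step_def)

lemma step_rtrancl_mono:
  "(u, w) \<in> (step h A \<phi>)\<^sup>* \<Longrightarrow> A \<subseteq> B \<Longrightarrow> (\<And>v. v \<in> A \<Longrightarrow> \<phi> v = \<psi> v)
     \<Longrightarrow> (u, w) \<in> (step h B \<psi>)\<^sup>*"
  by (meson rtrancl_mono step_mono subsetD)

lemma step_single_valued: "single_valued (step h A \<phi>)"
  by (auto simp: single_valued_def step_iff)

lemma step_terminal: "(u, w) \<in> (step h A \<phi>)\<^sup>* \<Longrightarrow> u \<notin> A \<Longrightarrow> w = u"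
  by (erule converse_rtranclE) (auto simp: step_iff)

text \<open>Each vertex has at most one outgoing step. If the one at \<open>v\<close> leads back to
  \<open>v\<close>, a path from \<open>v\<close> never leaves the cycle; this is what excludes
  cycles from forests.\<close>

lemma step_cycle_return:
  assumes "(w, v) \<in> (step h A \<phi>)\<^sup>*" "w = h v (\<phi> v)" "(v, r) \<in> (step h A \<phi>)\<^sup>*"
  shows "(r, v) \<in> (step h A \<phi>)\<^sup>*"
  using assms(3)
proof (induction rule: rtrancl_induct)
  case (step y z)
  show ?case
  proof (cases "y = v")
    case True
    then show ?thesis using step assms by (simp add: step_iff)
  next
    case False
    from step.IH False obtain z' where "(y, z') \<in> step h A \<phi>" "(z', v) \<in> (step h A \<phi>)\<^sup>*"
      by (auto elim: converse_rtranclE)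
    then show ?thesis using step.hyps by (simp add: step_iff)
  qed
qed simp

lemma sink_eqI:
  assumes "r \<notin> A" "(u, r) \<in> (step h A \<phi>)\<^sup>*"
  shows "sink h A \<phi> u = r"
  unfolding sink_def
proof (rule the_equality)
  fix r' assume "r' \<notin> A \<and> (u, r') \<in> (step h A \<phi>)\<^sup>*"
  then show "r' = r"
    using assms single_valued_confluent[OF step_single_valued, of u r h A \<phi> r']
      step_terminal by metis
qed (use assms in auto)

lemma sink_notin: "u \<notin> A \<Longrightarrow> sink h A \<phi> u = u"
  by (rule sink_eqI) auto

lemma forests_sink:
  assumes "\<phi> \<in> forests D h A (-A)"
  shows "sink h A \<phi> u \<notin> A" "(u, sink h A \<phi> u) \<in> (step h A \<phi>)\<^sup>*"
proof -
  obtain r where "r \<notin> A" "(u, r) \<in> (step h A \<phi>)\<^sup>*"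
    using assms by (cases "u \<in> A") (auto simp: forests_def)
  then show "sink h A \<phi> u \<notin> A" "(u, sink h A \<phi> u) \<in> (step h A \<phi>)\<^sup>*"
    by (simp_all add: sink_eqI)
qed

lemma forests_restrict: "\<phi> \<in> forests D h A S \<Longrightarrow> restrict \<phi> A = \<phi>"
  by (auto simp: forests_def fun_eq_iff PiE_def extensional_def)

lemma sink_step:
  assumes "\<phi> \<in> forests D h A (-A)" "u \<in> A"
  shows "sink h A \<phi> (h u (\<phi> u)) = sink h A \<phi> u"
proof (rule sym, rule sink_eqI)
  show "sink h A \<phi> (h u (\<phi> u)) \<notin> A"
    using forests_sink[OF assms(1)] by blast
  have "(u, h u (\<phi> u)) \<in> step h A \<phi>" using assms by (simp add: step_iff)
  then show "(u, sink h A \<phi> (h u (\<phi> u))) \<in> (step h A \<phi>)\<^sup>*"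
    using forests_sink(2)[OF assms(1)] by (meson converse_rtrancl_into_rtrancl)
qed

text \<open>The assumption \<open>good\<close> says that the new edge at \<open>v\<close> closes no
  cycle. Paths that ended at the root \<open>v\<close> now continue along \<open>e\<close>; all
  others are unchanged.\<close>

lemma forests_insertI:
  assumes \<psi>: "\<psi> \<in> forests D h A (-A)" and v: "v \<notin> A" and e: "e \<in> D v"
    and good: "sink h A \<psi> (h v e) \<noteq> v"
  shows "\<psi>(v := e) \<in> forests D h (insert v A) (- insert v A)"
    and "sink h (insert v A) (\<psi>(v := e)) u =
      (if sink h A \<psi> u = v then sink h A \<psi> (h v e) else sink h A \<psi> u)"
proof -
  let ?R = "step h (insert v A) (\<psi>(v := e))"
  have up: "(a, b) \<in> (step h A \<psi>)\<^sup>* \<Longrightarrow> (a, b) \<in> ?R\<^sup>*" for a b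
    by (erule step_rtrancl_mono) (use v in auto)
  have "(v, h v e) \<in> ?R" by (simp add: step_iff)
  moreover have "(h v e, sink h A \<psi> (h v e)) \<in> ?R\<^sup>*"
    using up forests_sink[OF \<psi>] by blast
  ultimately have ve: "(v, sink h A \<psi> (h v e)) \<in> ?R\<^sup>*"
    by (meson converse_rtrancl_into_rtrancl)
  have reach: "(u, if sink h A \<psi> u = v then sink h A \<psi> (h v e) else sink h A \<psi> u) \<in> ?R\<^sup>*" for u
    using up[OF forests_sink(2)[OF \<psi>], of u] ve by (auto intro: rtrancl_trans)
  have out: "(if sink h A \<psi> u = v then sink h A \<psi> (h v e) else sink h A \<psi> u) \<notin> insert v A" for u
    using good forests_sink(1)[OF \<psi>] by auto
  show "sink h (insert v A) (\<psi>(v := e)) u =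
      (if sink h A \<psi> u = v then sink h A \<psi> (h v e) else sink h A \<psi> u)"
    by (rule sink_eqI[OF out reach])
  have "\<psi>(v := e) \<in> PiE (insert v A) D"
    using \<psi> e by (auto simp: forests_def PiE_def extensional_def)
  then show "\<psi>(v := e) \<in> forests D h (insert v A) (- insert v A)"
    unfolding forests_def using reach out by blast
qed

text \<open>Inverse of \<open>forests_insertI\<close>: \<open>v\<close> becomes a root, and paths
  through \<open>v\<close> are cut there. A path from \<open>h v (\<phi> v)\<close> back to
  \<open>v\<close> would be a cycle, so the chosen edge is always admissible.\<close>

lemma forests_insertD:
  assumes \<phi>: "\<phi> \<in> forests D h (insert v A) (- insert v A)" and v: "v \<notin> A"
  shows "restrict \<phi> A \<in> forests D h A (-A)"
    and "\<phi> v \<in> D v"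
    and "sink h A (restrict \<phi> A) (h v (\<phi> v)) \<noteq> v"
    and "(restrict \<phi> A)(v := \<phi> v) = \<phi>"
proof -
  let ?R = "step h (insert v A) \<phi>" and ?Q = "step h A (restrict \<phi> A)"
  have P: "\<phi> \<in> PiE (insert v A) D" using \<phi> by (simp add: forests_def)
  show "\<phi> v \<in> D v" using P by auto
  show "(restrict \<phi> A)(v := \<phi> v) = \<phi>"
    using P by (auto simp: fun_eq_iff PiE_def extensional_def)
  have down: "\<exists>r'. r' \<notin> A \<and> (u, r') \<in> ?Q\<^sup>*" if "(u, r) \<in> ?R\<^sup>*" "r \<notin> insert v A" for u r
    using that
  proof (induction rule: converse_rtrancl_induct)
    case (step y z)
    show ?case
    proof (cases "y = v")
      case False
      then have "(y, z) \<in> ?Q" using step by (auto simp: step_iff)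
      then show ?thesis using step by (meson converse_rtrancl_into_rtrancl)
    qed (use v in auto)
  qed auto
  have "\<exists>r\<in>-A. (u, r) \<in> ?Q\<^sup>*" if "u \<in> A" for u
    using \<phi> down that unfolding forests_def by blast
  then show F: "restrict \<phi> A \<in> forests D h A (-A)"
    using P unfolding forests_def by auto
  show "sink h A (restrict \<phi> A) (h v (\<phi> v)) \<noteq> v"
  proof
    assume "sink h A (restrict \<phi> A) (h v (\<phi> v)) = v"
    then have "(h v (\<phi> v), v) \<in> ?Q\<^sup>*" using forests_sink(2)[OF F] by metis
    then have "(h v (\<phi> v), v) \<in> ?R\<^sup>*" by (rule step_rtrancl_mono) auto
    moreover obtain r where r: "r \<notin> insert v A" "(v, r) \<in> ?R\<^sup>*"
      using \<phi> unfolding forests_def by blast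
    ultimately have "(r, v) \<in> ?R\<^sup>*" by (meson step_cycle_return)
    then show False using r step_terminal by fastforce
  qed
qed

text \<open>The vertices of \<open>B - A\<close> are dropped one at a time, each turning into a
  root.\<close>

lemma forests_nonempty_subset:
  assumes "forests D h B (-B) \<noteq> {}" "finite B" "A \<subseteq> B"
  shows "forests D h A (-A) \<noteq> {}"
proof -
  have gen: "finite C \<Longrightarrow> forests D h (A \<union> C) (-(A \<union> C)) \<noteq> {} \<Longrightarrow> forests D h A (-A) \<noteq> {}" for C
  proof (induction C rule: finite_induct)
    case (insert c C)
    show ?case
    proof (cases "c \<in> A")
      case True
      then have "A \<union> insert c C = A \<union> C" by blast
      then show ?thesis using insert by metis
    next
      case False
      then have "c \<notin> A \<union> C" using insert by simp
      moreover obtain \<phi> where "\<phi> \<in> forests D h (insert c (A \<union> C)) (- insert c (A \<union> C))"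
        using insert.prems by auto
      ultimately have "restrict \<phi> (A \<union> C) \<in> forests D h (A \<union> C) (-(A \<union> C))"
        by (rule forests_insertD(1)[rotated])
      then show ?thesis using insert.IH by blast
    qed
  qed simp
  have "A \<union> B = B" using assms by blast
  then show ?thesis using gen[of B] assms by simp
qed

section \<open>Counting forests: hitting weights, harmonicity and submodularity\<close>

context
  fixes D :: "'v \<Rightarrow> 'e set" and h :: "'v \<Rightarrow> 'e \<Rightarrow> 'v"
begin

abbreviation "out_forests A \<equiv> forests D h A (-A)"

definition nforests :: "'v set \<Rightarrow> real" where
  "nforests A = real (card (out_forests A))"

text \<open>\<open>hits A z x / nforests A\<close> is the probability that a uniformly random forest
  leads from \<open>z\<close> to \<open>x\<close>. The unnormalized form stays meaningful when there
  is no forest.\<close>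

definition hits :: "'v set \<Rightarrow> 'v \<Rightarrow> 'v \<Rightarrow> real" where
  "hits A z x = (\<Sum>\<phi>\<in>out_forests A. of_bool (sink h A \<phi> z = x))"

lemma nforests_nonneg [simp]: "0 \<le> nforests A"
  by (simp add: nforests_def)

context
  assumes finD: "finite (D v)"
begin

lemma finite_forests: "finite A \<Longrightarrow> finite (forests D h A S)"
  by (rule finite_subset[of _ "PiE A D"]) (auto simp: forests_def intro: finite_PiE finD)

text \<open>The bijection given by \<open>forests_insertI\<close> and
  \<open>forests_insertD\<close>. Keeping \<open>g\<close> arbitrary lets it serve both
  \<open>nforests\<close> and \<open>hits\<close>.\<close>

lemma sum_forests_insert:
  fixes g :: "('v \<Rightarrow> 'e) \<Rightarrow> real"
  assumes A: "finite A" and v: "v \<notin> A"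
  shows "(\<Sum>\<phi>\<in>out_forests (insert v A). g \<phi>) =
    (\<Sum>\<psi>\<in>out_forests A. \<Sum>e | e \<in> D v \<and> sink h A \<psi> (h v e) \<noteq> v. g (\<psi>(v := e)))"
proof -
  have "(\<Sum>\<psi>\<in>out_forests A. \<Sum>e | e \<in> D v \<and> sink h A \<psi> (h v e) \<noteq> v. g (\<psi>(v := e))) =
      (\<Sum>(\<psi>, e)\<in>(SIGMA \<psi>:out_forests A. {e \<in> D v. sink h A \<psi> (h v e) \<noteq> v}). g (\<psi>(v := e)))"
    using A finD by (subst sum.Sigma) (auto simp: finite_forests)
  also have "\<dots> = (\<Sum>\<phi>\<in>out_forests (insert v A). g \<phi>)"
    by (rule sum.reindex_bij_witness[where i = "\<lambda>\<phi>. (restrict \<phi> A, \<phi> v)"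
          and j = "\<lambda>(\<psi>, e). \<psi>(v := e)"])
      (use v in \<open>auto simp: forests_insertD forests_restrict intro: forests_insertI(1)\<close>)
  finally show ?thesis by simp
qed

lemma hits_notin: "z \<notin> A \<Longrightarrow> hits A z x = (if z = x then nforests A else 0)"
  by (simp add: hits_def nforests_def sink_notin)

text \<open>The edge \<open>e\<close> is forbidden exactly for those forests on \<open>A\<close>
  that lead from \<open>h v e\<close> to \<open>v\<close>, and \<open>hits\<close> counts
  these.\<close>

lemma nforests_insert:
  assumes A: "finite A" and v: "v \<notin> A"
  shows "nforests (insert v A) = (\<Sum>e\<in>D v. nforests A - hits A (h v e) v)"
proof -
  have "nforests (insert v A) = (\<Sum>\<phi>\<in>out_forests (insert v A). 1)" by (simp add: nforests_def)
  also have "\<dots> = (\<Sum>\<psi>\<in>out_forests A. \<Sum>e\<in>D v. 1 - of_bool (sink h A \<psi> (h v e) = v))"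
    unfolding sum_forests_insert[OF A v]
    by (intro sum.cong refl sum.mono_neutral_cong_left) (use finD in auto)
  also have "\<dots> = (\<Sum>e\<in>D v. nforests A - hits A (h v e) v)"
    by (subst sum.swap) (simp add: sum_subtractf nforests_def hits_def)
  finally show ?thesis .
qed

text \<open>Split a forest on \<open>A\<close> into a forest \<open>\<psi>\<close> on
  \<open>A - {v}\<close> and an admissible edge \<open>e'\<close> at \<open>v\<close>. Another edge
  \<open>e\<close> at \<open>v\<close> leads to the root that \<open>\<psi>\<close> assigns it if
  \<open>e\<close> is admissible, and otherwise back to \<open>v\<close> and on along
  \<open>e'\<close>. Summed over all \<open>e\<close> and \<open>e'\<close>, every admissible edge
  is counted \<open>card (D v)\<close> times: once per admissible \<open>e'\<close> as
  \<open>e\<close>, and once per inadmissible \<open>e\<close> as \<open>e'\<close>.\<close>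

lemma hits_harmonic:
  assumes A: "finite A" and v: "v \<in> A" and x: "x \<notin> A"
  shows "(\<Sum>e\<in>D v. hits A (h v e) x) = real (card (D v)) * hits A v x"
proof -
  define B where "B = A - {v}"
  have AB: "A = insert v B" "v \<notin> B" "finite B" using A v by (auto simp: B_def)
  have xv: "x \<noteq> v" using x v by blast
  define good where "good \<psi> = {e \<in> D v. sink h B \<psi> (h v e) \<noteq> v}" for \<psi>
  define s where "s \<psi> e = (of_bool (sink h B \<psi> (h v e) = x) :: real)" for \<psi> e
  have [simp]: "finite (good \<psi>)" for \<psi> unfolding good_def using finD by simp
  have upd: "sink h A (\<psi>(v := e)) u =
      (if sink h B \<psi> u = v then sink h B \<psi> (h v e) else sink h B \<psi> u)"
    if "\<psi> \<in> out_forests B" "e \<in> good \<psi>" for \<psi> e u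
    unfolding AB(1) by (rule forests_insertI(2)) (use that AB in \<open>auto simp: good_def\<close>)
  have "(\<Sum>e\<in>D v. hits A (h v e) x) = (\<Sum>e\<in>D v. \<Sum>\<psi>\<in>out_forests B. \<Sum>e'\<in>good \<psi>.
      (if e \<in> good \<psi> then s \<psi> e else s \<psi> e'))"
    unfolding hits_def AB(1) sum_forests_insert[OF AB(3,2)] good_def[symmetric]
    by (intro sum.cong refl) (simp only: AB(1)[symmetric] upd, auto simp: good_def s_def)
  also have "\<dots> = (\<Sum>\<psi>\<in>out_forests B. \<Sum>e'\<in>good \<psi>. \<Sum>e\<in>D v.
      (if e \<in> good \<psi> then s \<psi> e else s \<psi> e'))"
    by (rule trans[OF sum.swap]) (intro sum.cong refl sum.swap)
  also have "\<dots> = (\<Sum>\<psi>\<in>out_forests B. real (card (D v)) * (\<Sum>e\<in>good \<psi>. s \<psi> e))"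
  proof (intro sum.cong refl)
    fix \<psi>
    have sub: "good \<psi> \<subseteq> D v" by (auto simp: good_def)
    have "(\<Sum>e\<in>D v. (if e \<in> good \<psi> then s \<psi> e else c)) =
        (\<Sum>e\<in>good \<psi>. s \<psi> e) + (real (card (D v)) - real (card (good \<psi>))) * c" for c
    proof -
      have "(\<Sum>e\<in>D v. (if e \<in> good \<psi> then s \<psi> e else c)) =
          (\<Sum>e\<in>D v - good \<psi>. c) + (\<Sum>e\<in>good \<psi>. s \<psi> e)"
        by (subst sum.subset_diff[OF sub finD]) (auto intro!: arg_cong2[where f = "(+)"] sum.cong)
      then show ?thesis
        using sub finD by (simp add: card_Diff_subset of_nat_diff card_mono)
    qed
    then have "(\<Sum>e'\<in>good \<psi>. \<Sum>e\<in>D v. (if e \<in> good \<psi> then s \<psi> e else s \<psi> e')) =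
        real (card (good \<psi>)) * (\<Sum>e\<in>good \<psi>. s \<psi> e)
        + (real (card (D v)) - real (card (good \<psi>))) * (\<Sum>e\<in>good \<psi>. s \<psi> e)"
      by (simp add: sum.distrib sum_distrib_left)
    then show "(\<Sum>e'\<in>good \<psi>. \<Sum>e\<in>D v. (if e \<in> good \<psi> then s \<psi> e else s \<psi> e')) =
        real (card (D v)) * (\<Sum>e\<in>good \<psi>. s \<psi> e)"
      by (simp add: algebra_simps)
  qed
  also have "\<dots> = real (card (D v)) * hits A v x"
    unfolding hits_def AB(1) sum_forests_insert[OF AB(3,2)] good_def[symmetric] sum_distrib_left
    by (intro sum.cong refl)
      (simp only: AB(1)[symmetric] upd, auto simp: sink_notin AB s_def)
  finally show ?thesis .
qed

lemma nforests_pos_iff: "finite A \<Longrightarrow> 0 < nforests A \<longleftrightarrow> out_forests A \<noteq> {}"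
  by (simp add: nforests_def card_gt_0_iff finite_forests)

lemma nforests_pos_subset: "0 < nforests B \<Longrightarrow> finite B \<Longrightarrow> A \<subseteq> B \<Longrightarrow> 0 < nforests A"
  by (metis nforests_pos_iff finite_subset forests_nonempty_subset)

text \<open>The difference of the two normalized hitting probabilities is harmonic on \<open>A\<close> and
  nonpositive off \<open>A\<close>, so the maximum principle applies.\<close>
lemma hits_mono:
  assumes A: "finite A" and x: "x \<notin> A" "x \<noteq> y"
    and pos: "0 < nforests (insert y A)"
  shows "hits A z x * nforests (insert y A) \<le> hits (insert y A) z x * nforests A"
proof -
  let ?B = "insert y A"
  have posA: "0 < nforests A" using nforests_pos_subset[OF pos, of A] A by auto
  define q where "q u = hits A u x / nforests A - hits ?B u x / nforests ?B" for u
  \<comment> \<open>At \<open>y\<close> the first quotient vanishes, since \<open>y\<close> is still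
    a root for \<open>A\<close>; elsewhere off \<open>A\<close> both quotients are the same
    indicator.\<close>
  have outside: "q u \<le> 0" if "u \<notin> A" for u
  proof (cases "u = y")
    case True
    have "0 \<le> hits ?B u x / nforests ?B" by (simp add: hits_def sum_nonneg)
    then show ?thesis using that True x by (simp add: q_def hits_notin)
  next
    case False
    then show ?thesis using that posA pos by (simp add: q_def hits_notin)
  qed
  have harmonic: "(\<Sum>e\<in>D u. q (h u e)) = real (card (D u)) * q u" if "u \<in> A" for u
    using hits_harmonic[of A u x] hits_harmonic[of ?B u x] A x that
    by (simp add: q_def sum_subtractf sum_divide_distrib[symmetric] right_diff_distrib)
  have "q z \<le> 0"
  proof (rule ccontr)
    assume z: "\<not> q z \<le> 0"
    then have zA: "z \<in> A" using outside by blast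
    define M where "M = Max (q ` A)"
    have "M \<in> q ` A" unfolding M_def by (rule Max_in) (use A zA in auto)
    then obtain v where v: "v \<in> A" "q v = M" by blast
    have M: "q u \<le> M" if "u \<in> A" for u unfolding M_def using A that by simp
    then have M0: "0 < M" using z zA by force
    then have M': "q u \<le> M" for u using M outside[of u] by (cases "u \<in> A") auto
    \<comment> \<open>Any forest gives a path from \<open>v\<close> out of \<open>A\<close>. By
      harmonicity a maximum spreads to all neighbours, hence along this path to a point outside,
      where \<open>q\<close> is nonpositive.\<close>
    obtain \<phi> where \<phi>: "\<phi> \<in> out_forests A" using posA A by (auto simp: nforests_pos_iff)
    have "q u = M" if "(v, u) \<in> (step h A \<phi>)\<^sup>*" for u
      using that
    proof (induction rule: rtrancl_induct)
      case (step u w)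
      have uA: "u \<in> A" and w: "w = h u (\<phi> u)" using step.hyps by (auto simp: step_iff)
      have "(\<Sum>e\<in>D u. M - q (h u e)) = 0"
        using harmonic[OF uA] step.IH by (simp add: sum_subtractf)
      then have "\<forall>e\<in>D u. M - q (h u e) = 0"
        by (subst (asm) sum_nonneg_eq_0_iff) (use finD M' in auto)
      moreover have "\<phi> u \<in> D u" using \<phi> uA by (auto simp: forests_def)
      ultimately show ?case using w by simp
    qed (use v in simp)
    then have "q (sink h A \<phi> v) = M" using forests_sink(2)[OF \<phi>] by blast
    then show False using outside[OF forests_sink(1)[OF \<phi>, of v]] M0 by linarith
  qed
  then show ?thesis using pos posA by (simp add: q_def field_simps)
qed

text \<open>Expanding the insertion of \<open>x\<close> by \<open>nforests_insert\<close> turns both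
  sides into sums over the edges at \<open>x\<close>, and \<open>hits_mono\<close> compares them
  term by term.\<close>

lemma nforests_submodular_local:
  assumes A: "finite A" and xy: "x \<notin> A" "y \<notin> A" "x \<noteq> y"
  shows "nforests (insert x (insert y A)) * nforests A \<le> nforests (insert y A) * nforests (insert x A)"
proof (cases "nforests (insert y A) = 0")
  case True
  then have "\<not> 0 < nforests (insert x (insert y A))"
    using nforests_pos_subset[of "insert x (insert y A)" "insert y A"] A by force
  then have "nforests (insert x (insert y A)) = 0"
    using nforests_nonneg[of "insert x (insert y A)"] by linarith
  then show ?thesis using True by simp
next
  case False
  then have pos: "0 < nforests (insert y A)" using nforests_nonneg[of "insert y A"] by linarith
  have "nforests (insert x (insert y A)) * nforests A
      = (\<Sum>e\<in>D x. nforests (insert y A) * nforests A - hits (insert y A) (h x e) x * nforests A)"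
    by (subst nforests_insert) (use A xy in \<open>auto simp: sum_distrib_right left_diff_distrib\<close>)
  also have "\<dots> \<le> (\<Sum>e\<in>D x. nforests (insert y A) * nforests A - hits A (h x e) x * nforests (insert y A))"
    by (intro sum_mono diff_left_mono hits_mono) (use A xy pos in auto)
  also have "\<dots> = nforests (insert y A) * nforests (insert x A)"
    by (subst nforests_insert[of A x]) (use A xy in \<open>auto simp: sum_distrib_left algebra_simps\<close>)
  finally show ?thesis .
qed

text \<open>Division-free form of chaining \<open>P/R \<le> S/Q\<close> and
  \<open>S/Q \<le> U/T\<close> for the counts. The cancelled factor \<open>nforests Q\<close> is
  positive because \<open>Q \<subseteq> P\<close>, unless \<open>nforests P\<close> is zero and the
  claim trivial.\<close>

lemma nforests_ratio_chain:
  assumes "nforests P * nforests Q \<le> nforests R * nforests S"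
    and "nforests S * nforests T \<le> nforests Q * nforests U" "finite P" "Q \<subseteq> P"
  shows "nforests P * nforests T \<le> nforests R * nforests U"
proof (cases "0 < nforests P")
  case False
  then have "nforests P = 0" using nforests_nonneg[of P] by linarith
  then show ?thesis by simp
next
  case True
  then have Q: "0 < nforests Q" using nforests_pos_subset assms by blast
  have "nforests Q * (nforests P * nforests T) = (nforests P * nforests Q) * nforests T" by simp
  also have "\<dots> \<le> (nforests R * nforests S) * nforests T"
    by (intro mult_right_mono assms nforests_nonneg)
  also have "\<dots> = nforests R * (nforests S * nforests T)" by simp
  also have "\<dots> \<le> nforests R * (nforests Q * nforests U)"
    by (intro mult_left_mono assms nforests_nonneg)
  finally show ?thesis using Q by (simp add: mult.left_commute)
qed

text \<open>Diminishing returns: the ratio \<open>nforests (insert x Z) / nforests Z\<close> falls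
  as \<open>Z\<close> grows from \<open>A\<close> to \<open>A \<union> Y\<close>, one vertex at a
  time.\<close>

lemma nforests_submodular_insert:
  assumes "finite Y" "finite A" "x \<notin> A" "x \<notin> Y"
  shows "nforests (insert x (A \<union> Y)) * nforests A \<le> nforests (A \<union> Y) * nforests (insert x A)"
  using assms
proof (induction Y rule: finite_induct)
  case (insert y Y)
  show ?case
  proof (cases "y \<in> A \<union> Y")
    case True
    then have "A \<union> insert y Y = A \<union> Y" by blast
    then show ?thesis using insert by simp
  next
    case False
    then have "nforests (insert x (insert y (A \<union> Y))) * nforests (A \<union> Y)
        \<le> nforests (insert y (A \<union> Y)) * nforests (insert x (A \<union> Y))"
      using insert by (intro nforests_submodular_local) auto
    moreover have "nforests (insert x (A \<union> Y)) * nforests A \<le> nforests (A \<union> Y) * nforests (insert x A)"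
      using insert by simp
    ultimately have "nforests (insert x (insert y (A \<union> Y))) * nforests A
        \<le> nforests (insert y (A \<union> Y)) * nforests (insert x A)"
      by (rule nforests_ratio_chain) (use insert in auto)
    then show ?thesis by simp
  qed
qed simp

lemma nforests_submodular:
  assumes A: "finite A" and B: "finite B"
  shows "nforests (A \<union> B) * nforests (A \<inter> B) \<le> nforests A * nforests B"
proof -
  let ?I = "A \<inter> B"
  \<comment> \<open>The vertices of \<open>X\<close> are added in parallel to \<open>A\<close> and
    to the smaller set \<open>A \<inter> B\<close>; the case \<open>X = B - A\<close> is the
    claim.\<close>
  have "finite X \<Longrightarrow> X \<inter> A = {} \<Longrightarrow> nforests (A \<union> X) * nforests ?I \<le> nforests (?I \<union> X) * nforests A" for X
  proof (induction X rule: finite_induct)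
    case empty
    then show ?case by simp
  next
    case (insert x X)
    have "nforests (insert x (?I \<union> X \<union> A)) * nforests (?I \<union> X)
        \<le> nforests (?I \<union> X \<union> A) * nforests (insert x (?I \<union> X))"
      using insert A by (intro nforests_submodular_insert) auto
    moreover have "?I \<union> X \<union> A = A \<union> X" by blast
    ultimately have "nforests (insert x (A \<union> X)) * nforests (?I \<union> X)
        \<le> nforests (insert x (?I \<union> X)) * nforests (A \<union> X)"
      by (simp add: mult.commute)
    moreover have "nforests (A \<union> X) * nforests ?I \<le> nforests (?I \<union> X) * nforests A" using insert by simp
    ultimately have "nforests (insert x (A \<union> X)) * nforests ?I \<le> nforests (insert x (?I \<union> X)) * nforests A"
      by (rule nforests_ratio_chain) (use insert A in auto)
    then show ?case by simp
  qed
  from this[of "B - A"] have "nforests (A \<union> (B - A)) * nforests ?I \<le> nforests (?I \<union> (B - A)) * nforests A"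
    using B by blast
  moreover have "?I \<union> (B - A) = B" by blast
  ultimately show ?thesis by (simp add: mult.commute)
qed

end

end

section \<open>Gluing forests and transporting them along injective maps\<close>

lemma forests_mono: "S \<subseteq> S' \<Longrightarrow> forests D h A S \<subseteq> forests D h A S'"
  unfolding forests_def by blast

text \<open>A path from \<open>B\<close> that ends in \<open>A\<close> instead of \<open>S\<close>
  is continued by \<open>\<phi>\<close>.\<close>

lemma forests_Un:
  assumes \<phi>: "\<phi> \<in> forests D h A S" and \<psi>: "\<psi> \<in> forests D h B (A \<union> S)" and AB: "A \<inter> B = {}"
  shows "(\<lambda>v. if v \<in> A then \<phi> v else \<psi> v) \<in> forests D h (A \<union> B) S"
proof -
  let ?\<chi> = "\<lambda>v. if v \<in> A then \<phi> v else \<psi> v"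
  have up1: "(u, w) \<in> (step h A \<phi>)\<^sup>* \<Longrightarrow> (u, w) \<in> (step h (A \<union> B) ?\<chi>)\<^sup>*" for u w
    by (erule step_rtrancl_mono) auto
  have up2: "(u, w) \<in> (step h B \<psi>)\<^sup>* \<Longrightarrow> (u, w) \<in> (step h (A \<union> B) ?\<chi>)\<^sup>*" for u w
    by (erule step_rtrancl_mono) (use AB in auto)
  have A: "\<exists>r\<in>S. (v, r) \<in> (step h (A \<union> B) ?\<chi>)\<^sup>*" if "v \<in> A" for v
    using \<phi> that up1 unfolding forests_def by blast
  have "\<exists>r\<in>S. (v, r) \<in> (step h (A \<union> B) ?\<chi>)\<^sup>*" if v: "v \<in> B" for v
  proof -
    obtain w where w: "w \<in> A \<union> S" "(v, w) \<in> (step h (A \<union> B) ?\<chi>)\<^sup>*"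
      using \<psi> v up2 unfolding forests_def by blast
    show ?thesis
      using w A[of w] by (meson UnE rtrancl_trans)
  qed
  moreover have "?\<chi> \<in> PiE (A \<union> B) D"
    using \<phi> \<psi> by (auto simp: forests_def PiE_def extensional_def Pi_def)
  ultimately show ?thesis unfolding forests_def using A by blast
qed

text \<open>Both parts can be read off from the glued map, as \<open>A\<close> and \<open>B\<close>
  are disjoint. Forests on the union whose paths from \<open>A\<close> run through \<open>B\<close>
  need not arise, hence only an inequality.\<close>

lemma card_forests_Un:
  assumes fin: "finite A" "finite B" "\<And>v. finite (D v)" and AB: "A \<inter> B = {}"
  shows "card (forests D h A S) * card (forests D h B (A \<union> S)) \<le> card (forests D h (A \<union> B) S)"
proof -
  have "inj_on (\<lambda>(\<phi>, \<psi>) v. if v \<in> A then \<phi> v else \<psi> v)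
      (forests D h A S \<times> forests D h B (A \<union> S))"
  proof (rule inj_onI, clarify)
    fix \<phi> \<psi> \<phi>' \<psi>'
    assume F: "\<phi> \<in> forests D h A S" "\<phi>' \<in> forests D h A S"
      "\<psi> \<in> forests D h B (A \<union> S)" "\<psi>' \<in> forests D h B (A \<union> S)"
      and eq: "(\<lambda>v. if v \<in> A then \<phi> v else \<psi> v) = (\<lambda>v. if v \<in> A then \<phi>' v else \<psi>' v)"
    have "\<phi> v = \<phi>' v" if "v \<in> A" for v using fun_cong[OF eq, of v] that by simp
    moreover have "\<psi> v = \<psi>' v" if "v \<in> B" for v
      using fun_cong[OF eq, of v] that AB by (auto split: if_splits)
    ultimately show "\<phi> = \<phi>' \<and> \<psi> = \<psi>'"
      using F by (auto simp: forests_def intro: PiE_ext)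
  qed
  moreover have "(\<lambda>(\<phi>, \<psi>) v. if v \<in> A then \<phi> v else \<psi> v) `
      (forests D h A S \<times> forests D h B (A \<union> S)) \<subseteq> forests D h (A \<union> B) S"
    using forests_Un[OF _ _ AB] by auto
  ultimately have "card (forests D h A S \<times> forests D h B (A \<union> S)) \<le> card (forests D h (A \<union> B) S)"
    using fin by (intro card_inj_on_le) (auto intro: finite_forests)
  then show ?thesis by (simp add: card_cartesian_product)
qed

text \<open>Choices are pushed forward along \<open>f\<close> and \<open>g\<close> and can be
  recovered by injectivity. The target may offer further edges at \<open>f v\<close>, hence only an
  inequality.\<close>

lemma card_forests_embed:
  assumes fin: "finite A" "\<And>v. finite (D' v)"
    and f: "inj_on f A" and g: "inj_on g E"
    and D: "\<And>v. v \<in> A \<Longrightarrow> D v \<subseteq> E"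
    and compat: "\<And>v e. v \<in> A \<Longrightarrow> e \<in> D v \<Longrightarrow> g e \<in> D' (f v) \<and> h' (f v) (g e) = f (h v e)"
  shows "card (forests D h A S) \<le> card (forests D' h' (f ` A) (f ` S))"
proof -
  define t where "t \<phi> = restrict (\<lambda>x. g (\<phi> (inv_into A f x))) (f ` A)" for \<phi>
  have t: "t \<phi> (f v) = g (\<phi> v)" if "v \<in> A" for \<phi> v using that f by (simp add: t_def)
  have "inj_on t (forests D h A S)"
  proof (rule inj_onI)
    fix \<phi> \<psi> assume F: "\<phi> \<in> forests D h A S" "\<psi> \<in> forests D h A S" and eq: "t \<phi> = t \<psi>"
    have "\<phi> v = \<psi> v" if v: "v \<in> A" for v
    proof -
      have "g (\<phi> v) = g (\<psi> v)" using t[OF v] eq by metis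
      moreover have "\<phi> v \<in> D v" "\<psi> v \<in> D v" using F v by (auto simp: forests_def)
      then have "\<phi> v \<in> E" "\<psi> v \<in> E" using D[OF v] by auto
      ultimately show ?thesis using g by (simp add: inj_on_eq_iff)
    qed
    then show "\<phi> = \<psi>" using F by (auto simp: forests_def intro: PiE_ext)
  qed
  moreover have "t ` forests D h A S \<subseteq> forests D' h' (f ` A) (f ` S)"
  proof clarify
    fix \<phi> assume \<phi>: "\<phi> \<in> forests D h A S"
    have mem: "\<phi> v \<in> D v" if "v \<in> A" for v using \<phi> that by (auto simp: forests_def)
    have "(f u, f w) \<in> (step h' (f ` A) (t \<phi>))\<^sup>*" if "(u, w) \<in> (step h A \<phi>)\<^sup>*" for u w
      using that
    proof (induction rule: rtrancl_induct)
      case (step y z)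
      then have "(f y, f z) \<in> step h' (f ` A) (t \<phi>)"
        using compat mem t by (auto simp: step_iff)
      then show ?case using step.IH by (rule rtrancl_into_rtrancl[rotated])
    qed simp
    then have "\<forall>v\<in>f ` A. \<exists>r\<in>f ` S. (v, r) \<in> (step h' (f ` A) (t \<phi>))\<^sup>*"
      using \<phi> unfolding forests_def by blast
    moreover have "t \<phi> \<in> PiE (f ` A) D'"
      using compat mem t by (auto simp: t_def)
    ultimately show "t \<phi> \<in> forests D' h' (f ` A) (f ` S)" by (simp add: forests_def)
  qed
  ultimately show ?thesis
    using fin by (intro card_inj_on_le) (auto intro: finite_forests)
qed

section \<open>Multigraph edges as outgoing choices\<close>

text \<open>Choices are the edges themselves, so parallel edges stay distinct. Loops are left out
  because they lie in no tree.\<close>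

definition darts :: "'e set \<Rightarrow> ('e \<Rightarrow> 'a set) \<Rightarrow> 'a \<Rightarrow> 'e set" where
  "darts E ends v = {e \<in> E. v \<in> ends e \<and> card (ends e) = 2}"

definition other :: "('e \<Rightarrow> 'a set) \<Rightarrow> 'a \<Rightarrow> 'e \<Rightarrow> 'a" where
  "other ends v e = (THE w. ends e = {v, w})"

lemma other_eqI: "ends e = {v, w} \<Longrightarrow> other ends v e = w"
  unfolding other_def by (rule the_equality) (auto simp: doubleton_eq_iff)

lemma dartsD:
  assumes "e \<in> darts E ends v"
  shows "e \<in> E" "ends e = {v, other ends v e}" "other ends v e \<noteq> v"
proof -
  obtain x y where xy: "ends e = {x, y}" "x \<noteq> y"
    using assms by (auto simp: darts_def card_2_iff)
  moreover have "v \<in> ends e" using assms by (simp add: darts_def)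
  ultimately obtain w where w: "ends e = {v, w}" "w \<noteq> v" by (auto simp: insert_commute)
  then have "other ends v e = w" by (simp add: other_eqI)
  then show "e \<in> E" "ends e = {v, other ends v e}" "other ends v e \<noteq> v"
    using w assms by (auto simp: darts_def)
qed

lemma dartsI: "e \<in> E \<Longrightarrow> ends e = {v, w} \<Longrightarrow> v \<noteq> w \<Longrightarrow> e \<in> darts E ends v"
  by (simp add: darts_def)

lemma sym_adj_via: "sym (adj_via F ends)"
  by (auto simp: sym_def adj_via_def insert_commute)

lemma adj_via_commute: "(x, y) \<in> (adj_via F ends)\<^sup>* \<Longrightarrow> (y, x) \<in> (adj_via F ends)\<^sup>*"
  by (meson sym_adj_via sym_rtrancl symD)

lemma adj_via_mono: "F \<subseteq> F' \<Longrightarrow> (x, y) \<in> (adj_via F ends)\<^sup>* \<Longrightarrow> (x, y) \<in> (adj_via F' ends)\<^sup>*"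
  by (rule subsetD[OF rtrancl_mono]) (auto simp: adj_via_def)

lemma embedding_darts:
  assumes emb: "embedding VH EH endsH VG EG endsG f g"
    and H: "multigraph VH EH endsH" and e: "e \<in> darts EH endsH v"
  shows "g e \<in> darts EG endsG (f v) \<and> other endsG (f v) (g e) = f (other endsH v e)"
proof -
  let ?w = "other endsH v e"
  have "endsH e \<subseteq> VH" using H dartsD(1)[OF e] by (simp add: multigraph_def)
  then have "v \<in> VH" "?w \<in> VH" using dartsD(2)[OF e] by auto
  then have "f v \<noteq> f ?w"
    using emb dartsD(3)[OF e] by (auto simp: embedding_def inj_on_def)
  moreover have "endsG (g e) = f ` endsH e" "g e \<in> EG"
    using emb dartsD(1)[OF e] by (auto simp: embedding_def)
  moreover have "f ` endsH e = {f v, f ?w}" by (subst dartsD(2)[OF e]) simp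
  ultimately show ?thesis by (auto intro: dartsI other_eqI)
qed

lemma finite_darts: "multigraph V E ends \<Longrightarrow> finite (darts E ends v)"
  by (simp add: darts_def multigraph_def)

lemma other_in:
  assumes "multigraph V E ends" "e \<in> darts E ends v"
  shows "other ends v e \<in> V"
  using assms(1) dartsD(1,2)[OF assms(2)] by (auto simp: multigraph_def)

lemma card_forests_embedding:
  assumes emb: "embedding VH EH endsH VG EG endsG f g"
    and H: "multigraph VH EH endsH" and G: "multigraph VG EG endsG" and A: "A \<subseteq> VH"
  shows "card (forests (darts EH endsH) (other endsH) A S)
    \<le> card (forests (darts EG endsG) (other endsG) (f ` A) (f ` S))"
proof (rule card_forests_embed[where g = g and E = EH])
  show "finite A" using H A by (auto simp: multigraph_def intro: finite_subset)
  show "inj_on f A" using emb A by (auto simp: embedding_def intro: inj_on_subset)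
  show "inj_on g EH" using emb by (simp add: embedding_def)
qed (use embedding_darts[OF emb H] finite_darts[OF G] in \<open>auto simp: darts_def\<close>)

section \<open>Forests rooted at a single vertex and spanning trees\<close>

lemma step_closed:
  assumes "multigraph V E ends" "\<phi> \<in> forests (darts E ends) (other ends) A S"
    and "(u, w) \<in> (step (other ends) A \<phi>)\<^sup>*" "u \<in> V"
  shows "w \<in> V"
  using assms(3)
proof (induction rule: rtrancl_induct)
  case (step y z)
  then have "\<phi> y \<in> darts E ends y" "z = other ends y (\<phi> y)"
    using assms(2) by (auto simp: step_iff forests_def)
  then show ?case using other_in[OF assms(1)] by simp
qed (use assms in simp)

text \<open>Paths along darts stay inside \<open>V\<close>. This translates between the roots
  \<open>-A\<close> of the counting results and the actual vertices outside
  \<open>A\<close>.\<close>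

lemma forests_target:
  assumes "multigraph V E ends" "A \<subseteq> V"
  shows "forests (darts E ends) (other ends) A (-A) = forests (darts E ends) (other ends) A (V - A)"
proof
  show "forests (darts E ends) (other ends) A (-A) \<subseteq> forests (darts E ends) (other ends) A (V - A)"
  proof
    fix \<phi> assume \<phi>: "\<phi> \<in> forests (darts E ends) (other ends) A (-A)"
    have "\<exists>r\<in>V - A. (v, r) \<in> (step (other ends) A \<phi>)\<^sup>*" if "v \<in> A" for v
      using forests_sink[OF \<phi>, of v] step_closed[OF assms(1) \<phi>] that assms(2) by blast
    then show "\<phi> \<in> forests (darts E ends) (other ends) A (V - A)"
      using \<phi> by (simp add: forests_def)
  qed
qed (auto intro: forests_mono[THEN subsetD])

lemma step_subset_adj_via:
  assumes "\<phi> \<in> PiE A (darts E ends)" "\<phi> ` A \<subseteq> F"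
  shows "step (other ends) A \<phi> \<subseteq> adj_via F ends"
proof clarify
  fix u w assume "(u, w) \<in> step (other ends) A \<phi>"
  then have u: "u \<in> A" "w = other ends u (\<phi> u)" by (simp_all add: step_iff)
  then have "ends (\<phi> u) = {u, w}" using assms(1) dartsD(2) by (metis PiE_mem)
  then show "(u, w) \<in> adj_via F ends" using u assms(2) by (auto simp: adj_via_def)
qed

text \<open>Removing the edge \<open>\<phi> v\<close> from the tree separates \<open>v\<close> from the root \<open>z\<close>, but not the other
  endpoint. This recovers \<open>\<phi>\<close> from its range.\<close>
lemma forests_parent:
  assumes G: "multigraph V E ends" and z: "z \<in> V"
    and \<phi>: "\<phi> \<in> forests (darts E ends) (other ends) (V - {z}) {z}"
    and v: "v \<in> V - {z}"
  defines "F \<equiv> \<phi> ` (V - {z}) - {\<phi> v}"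
  shows "(other ends v (\<phi> v), z) \<in> (adj_via F ends)\<^sup>*" "(v, z) \<notin> (adj_via F ends)\<^sup>*"
proof -
  define B where "B = V - {z} - {v}"
  define \<psi> where "\<psi> = restrict \<phi> B"
  let ?D = "darts E ends" and ?h = "other ends"
  have AB: "V - {z} = insert v B" "v \<notin> B" using v by (auto simp: B_def)
  have "\<phi> \<in> forests ?D ?h (V - {z}) (- (V - {z}))"
    using \<phi> by (rule forests_mono[THEN subsetD, rotated]) auto
  note ins = forests_insertD[OF this[unfolded AB(1)] AB(2), folded \<psi>_def]
  have mem: "\<phi> u \<in> ?D u" if "u \<in> V - {z}" for u using \<phi> that by (auto simp: forests_def)
  \<comment> \<open>An edge chosen at both of its ends would form a cycle of length two.\<close>
  have uniq: "\<phi> u \<noteq> \<phi> v" if u: "u \<in> B" for u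
  proof
    assume eq: "\<phi> u = \<phi> v"
    have "u \<in> {v, ?h v (\<phi> v)}" "ends (\<phi> u) = {v, ?h v (\<phi> v)}"
      using dartsD(2)[OF mem[OF v]] dartsD(2)[OF mem[of u]] u eq by (auto simp: B_def)
    then have "u = ?h v (\<phi> v)" "?h u (\<phi> u) = v"
      using u AB(2) by (auto intro: other_eqI simp: insert_commute)
    then have "sink ?h B \<psi> (?h v (\<phi> v)) = v"
      using sink_step[OF ins(1) u] u AB(2) by (simp add: \<psi>_def sink_notin)
    then show False using ins(3) by simp
  qed
  have "\<psi> ` B \<subseteq> F" using uniq AB by (auto simp: F_def \<psi>_def)
  then have "step ?h B \<psi> \<subseteq> adj_via F ends"
    using ins(1) by (intro step_subset_adj_via) (auto simp: forests_def)
  then have "(?h v (\<phi> v), sink ?h B \<psi> (?h v (\<phi> v))) \<in> (adj_via F ends)\<^sup>*"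
    using forests_sink(2)[OF ins(1)] rtrancl_mono by blast
  moreover have "sink ?h B \<psi> (?h v (\<phi> v)) = z"
  proof -
    have "sink ?h B \<psi> (?h v (\<phi> v)) \<in> V"
      by (rule step_closed[OF G ins(1) forests_sink(2)[OF ins(1)]]) (rule other_in[OF G mem[OF v]])
    moreover have "sink ?h B \<psi> (?h v (\<phi> v)) \<notin> B" by (rule forests_sink(1)[OF ins(1)])
    ultimately show ?thesis using ins(3) by (auto simp: B_def)
  qed
  ultimately show "(?h v (\<phi> v), z) \<in> (adj_via F ends)\<^sup>*" by simp
  \<comment> \<open>The sink is constant on the components of \<open>F\<close>, and it separates
    \<open>v\<close> from \<open>z\<close> because both are roots for \<open>B\<close>.\<close>
  have inv: "sink ?h B \<psi> a = sink ?h B \<psi> b" if ab: "(a, b) \<in> adj_via F ends" for a b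
  proof -
    obtain u where u: "u \<in> B" "ends (\<phi> u) = {a, b}"
      using ab AB by (auto simp: adj_via_def F_def)
    then have "{u, ?h u (\<phi> u)} = {a, b}" using dartsD(2)[OF mem[of u]] AB by simp
    moreover have "sink ?h B \<psi> (?h u (\<phi> u)) = sink ?h B \<psi> u"
      using sink_step[OF ins(1) u(1)] u by (simp add: \<psi>_def)
    ultimately show ?thesis by (auto simp: doubleton_eq_iff)
  qed
  show "(v, z) \<notin> (adj_via F ends)\<^sup>*"
  proof
    assume "(v, z) \<in> (adj_via F ends)\<^sup>*"
    then have "sink ?h B \<psi> v = sink ?h B \<psi> z"
      by (induction rule: rtrancl_induct) (auto dest: inv)
    then show False using v by (simp add: sink_notin B_def)
  qed
qed

text \<open>Paths to \<open>z\<close> give connectivity. If a walk avoiding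
  \<open>e = \<phi> v\<close> joined the ends of \<open>e\<close>, then \<open>v\<close> would still
  be connected to \<open>z\<close>, against \<open>forests_parent\<close>.\<close>

lemma forests_spanning_tree:
  assumes G: "multigraph V E ends" and z: "z \<in> V"
    and \<phi>: "\<phi> \<in> forests (darts E ends) (other ends) (V - {z}) {z}"
  shows "spanning_tree V E ends (\<phi> ` (V - {z}))"
proof -
  let ?T = "\<phi> ` (V - {z})"
  have P: "\<phi> \<in> PiE (V - {z}) (darts E ends)" using \<phi> by (simp add: forests_def)
  have mem: "\<phi> u \<in> darts E ends u" if "u \<in> V - {z}" for u using P that by auto
  have "(v, z) \<in> (adj_via ?T ends)\<^sup>*" if "v \<in> V" for v
  proof (cases "v = z")
    case False
    then have "(v, z) \<in> (step (other ends) (V - {z}) \<phi>)\<^sup>*"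
      using \<phi> that by (auto simp: forests_def)
    then show ?thesis using step_subset_adj_via[OF P order_refl] rtrancl_mono by blast
  qed simp
  then have "connected_via V ?T ends"
    unfolding connected_via_def using z adj_via_commute by (metis empty_iff rtrancl_trans)
  moreover have "acyclic_edges ?T ends"
    unfolding acyclic_edges_def
  proof (intro ballI conjI allI impI)
    fix e assume "e \<in> ?T"
    then obtain v where v: "v \<in> V - {z}" "e = \<phi> v" by blast
    show "card (ends e) = 2" using mem[OF v(1)] v by (simp add: darts_def)
    fix x y assume xy: "ends e = {x, y}"
    show "(x, y) \<notin> (adj_via (?T - {e}) ends)\<^sup>*"
    proof
      assume *: "(x, y) \<in> (adj_via (?T - {e}) ends)\<^sup>*"
      have "{x, y} = {v, other ends v e}" using xy dartsD(2)[OF mem[OF v(1)]] v by simp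
      then have "(v, other ends v e) \<in> (adj_via (?T - {e}) ends)\<^sup>*"
        using * adj_via_commute[OF *] by (auto simp: doubleton_eq_iff)
      then show False
        using forests_parent[OF G z \<phi> v(1)] v(2) by (metis rtrancl_trans)
    qed
  qed
  moreover have "?T \<subseteq> E" using mem by (auto simp: darts_def)
  ultimately show ?thesis by (simp add: spanning_tree_def)
qed

text \<open>Deleting an edge from the common range cuts exactly one of its ends off from
  \<open>z\<close>. Both maps must assign the edge to that end.\<close>

lemma inj_on_forests_image:
  assumes G: "multigraph V E ends" and z: "z \<in> V"
  shows "inj_on (\<lambda>\<phi>. \<phi> ` (V - {z})) (forests (darts E ends) (other ends) (V - {z}) {z})"
proof (rule inj_onI)
  fix \<phi> \<psi>
  assume \<phi>: "\<phi> \<in> forests (darts E ends) (other ends) (V - {z}) {z}"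
    and \<psi>: "\<psi> \<in> forests (darts E ends) (other ends) (V - {z}) {z}"
    and eq: "\<phi> ` (V - {z}) = \<psi> ` (V - {z})"
  have "\<phi> u = \<psi> u" if u: "u \<in> V - {z}" for u
  proof -
    obtain v where v: "v \<in> V - {z}" "\<phi> u = \<psi> v" using eq u by blast
    have "\<phi> u \<in> darts E ends u" "\<psi> v \<in> darts E ends v"
      using \<phi> \<psi> u v(1) by (auto simp: forests_def)
    then have "{u, other ends u (\<phi> u)} = {v, other ends v (\<psi> v)}"
      using v dartsD(2) by metis
    moreover have "u \<noteq> other ends v (\<psi> v)"
      using forests_parent(2)[OF G z \<phi> u] forests_parent(1)[OF G z \<psi> v(1)] eq v(2) by auto
    ultimately show ?thesis using v by (auto simp: doubleton_eq_iff)
  qed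
  then show "\<phi> = \<psi>" using \<phi> \<psi> by (auto simp: forests_def intro: PiE_ext)
qed

text \<open>Each vertex chooses an edge of \<open>T\<close> that decreases its distance to
  \<open>z\<close> in \<open>T\<close>. The chosen edges already connect \<open>V\<close>, so a
  further edge of \<open>T\<close> would close a cycle.\<close>

lemma spanning_tree_image:
  assumes G: "multigraph V E ends" and z: "z \<in> V" and T: "spanning_tree V E ends T"
  shows "\<exists>\<phi>\<in>forests (darts E ends) (other ends) (V - {z}) {z}. \<phi> ` (V - {z}) = T"
proof -
  let ?R = "adj_via T ends" and ?h = "other ends"
  define dist where "dist v = (LEAST n. (v, z) \<in> ?R ^^ n)" for v
  have TE: "T \<subseteq> E" and conn: "connected_via V T ends" and acyc: "acyclic_edges T ends"
    using T by (auto simp: spanning_tree_def)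
  have ex: "\<exists>e. e \<in> darts T ends v \<and> dist (?h v e) < dist v" if v: "v \<in> V - {z}" for v
  proof -
    have "(v, z) \<in> ?R\<^sup>*" using conn z v by (auto simp: connected_via_def)
    then have d: "(v, z) \<in> ?R ^^ dist v"
      unfolding dist_def by (meson LeastI_ex rtrancl_imp_relpow)
    then obtain m where m: "dist v = Suc m" using v by (cases "dist v") auto
    then obtain u where u: "(v, u) \<in> ?R" "(u, z) \<in> ?R ^^ m"
      using d by (metis relpow_Suc_D2)
    then obtain e where e: "e \<in> T" "ends e = {v, u}" by (auto simp: adj_via_def)
    then have "card {v, u} = 2" using acyc by (auto simp: acyclic_edges_def)
    then have "v \<noteq> u" by auto
    moreover have "dist u \<le> m" unfolding dist_def by (rule Least_le) (rule u)
    ultimately show ?thesis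
      using e m by (intro exI[of _ e]) (auto intro: dartsI simp: other_eqI)
  qed
  define \<phi> where "\<phi> = restrict (\<lambda>v. SOME e. e \<in> darts T ends v \<and> dist (?h v e) < dist v) (V - {z})"
  have sel: "\<phi> v \<in> darts T ends v \<and> dist (?h v (\<phi> v)) < dist v" if "v \<in> V - {z}" for v
    using someI_ex[OF ex[OF that]] that by (simp add: \<phi>_def)
  have sub: "darts T ends v \<subseteq> darts E ends v" for v using TE by (auto simp: darts_def)
  have "v \<in> V \<Longrightarrow> (v, z) \<in> (step ?h (V - {z}) \<phi>)\<^sup>*" for v
  proof (induction "dist v" arbitrary: v rule: less_induct)
    case less
    show ?case
    proof (cases "v = z")
      case False
      then have v: "v \<in> V - {z}" using less by simp
      then have "\<phi> v \<in> darts E ends v" using sel sub by blast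
      then have "?h v (\<phi> v) \<in> V" by (rule other_in[OF G])
      then have "(?h v (\<phi> v), z) \<in> (step ?h (V - {z}) \<phi>)\<^sup>*" using less sel[OF v] by blast
      moreover have "(v, ?h v (\<phi> v)) \<in> step ?h (V - {z}) \<phi>" using v by (simp add: step_iff)
      ultimately show ?thesis by (rule converse_rtrancl_into_rtrancl[rotated])
    qed simp
  qed
  moreover have "\<phi> \<in> PiE (V - {z}) (darts E ends)"
    using sel sub by (auto simp: \<phi>_def)
  ultimately have F: "\<phi> \<in> forests (darts E ends) ?h (V - {z}) {z}" by (auto simp: forests_def)
  have subT: "\<phi> ` (V - {z}) \<subseteq> T" using sel by (auto simp: darts_def)
  have conn': "connected_via V (\<phi> ` (V - {z})) ends"
    using forests_spanning_tree[OF G z F] by (simp add: spanning_tree_def)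
  have "T \<subseteq> \<phi> ` (V - {z})"
  proof (rule subsetI, rule ccontr)
    fix e assume e: "e \<in> T" "e \<notin> \<phi> ` (V - {z})"
    then obtain x y where xy: "ends e = {x, y}"
      using acyc by (auto simp: acyclic_edges_def card_2_iff)
    have "ends e \<subseteq> V" using G e TE by (auto simp: multigraph_def)
    then have "x \<in> V" "y \<in> V" using xy by auto
    then have "(x, y) \<in> (adj_via (\<phi> ` (V - {z})) ends)\<^sup>*" using conn' by (auto simp: connected_via_def)
    then have "(x, y) \<in> (adj_via (T - {e}) ends)\<^sup>*" by (rule adj_via_mono[rotated]) (use subT e in auto)
    then show False using acyc e xy by (auto simp: acyclic_edges_def)
  qed
  then show ?thesis using F subT by blast
qed

lemma card_forests_tree:
  assumes "multigraph V E ends" "z \<in> V"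
  shows "card (forests (darts E ends) (other ends) (V - {z}) {z}) = num_spanning_trees V E ends"
proof -
  have "{T. spanning_tree V E ends T}
      = (\<lambda>\<phi>. \<phi> ` (V - {z})) ` forests (darts E ends) (other ends) (V - {z}) {z}"
    using forests_spanning_tree[OF assms] spanning_tree_image[OF assms] by blast
  then show ?thesis
    by (simp add: num_spanning_trees_def card_image inj_on_forests_image[OF assms])
qed

section \<open>Attaching a vertex by a boundary edge\<close>

lemma boundary_edge:
  assumes G: "multigraph V E ends" and conn: "connected_via V E ends"
    and U: "U \<subseteq> V" "U \<noteq> {}" "U \<noteq> V"
  shows "\<exists>e\<in>E. \<exists>v\<in>V - U. \<exists>u\<in>U. ends e = {v, u}"
proof (rule ccontr)
  assume no: "\<not> ?thesis"
  obtain x y where x: "x \<in> U" and y: "y \<in> V" "y \<notin> U" using U by blast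
  then have "(x, y) \<in> (adj_via E ends)\<^sup>*" using conn U by (auto simp: connected_via_def)
  then have "y \<in> U"
  proof (induction rule: rtrancl_induct)
    case (step a b)
    then obtain e where e: "e \<in> E" "ends e = {b, a}" by (auto simp: adj_via_def insert_commute)
    then have "b \<in> V" using G by (auto simp: multigraph_def)
    then show ?case using no e step.IH by blast
  qed (rule x)
  then show False using y by simp
qed

lemma forests_single_edge:
  assumes "e \<in> E" "ends e = {v, u}" "v \<notin> U" "u \<in> U"
  shows "forests (darts E ends) (other ends) {v} U \<noteq> {}"
proof -
  have "v \<noteq> u" using assms by blast
  then have "restrict (\<lambda>_. e) {v} \<in> PiE {v} (darts E ends)" using assms by (auto intro: dartsI)
  moreover have "(v, u) \<in> (step (other ends) {v} (restrict (\<lambda>_. e) {v}))\<^sup>*"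
    using assms by (intro r_into_rtrancl) (simp add: step_iff other_eqI)
  ultimately show ?thesis using assms unfolding forests_def by blast
qed

text \<open>The edge \<open>e\<close> alone is a forest on \<open>{v}\<close> rooted in
  \<open>U\<close>, so the root \<open>v\<close> can be made a forest vertex without loss.\<close>

lemma card_forests_insert_boundary:
  assumes G: "multigraph V E ends" and B: "finite B" "v \<notin> B"
    and e: "e \<in> E" "ends e = {v, u}" "v \<notin> U" "u \<in> U"
  shows "card (forests (darts E ends) (other ends) B (insert v U))
    \<le> card (forests (darts E ends) (other ends) (insert v B) U)"
proof -
  have "0 < card (forests (darts E ends) (other ends) {v} U)"
    using forests_single_edge[of e E ends v u U] e finite_darts[OF G]
    by (simp add: card_gt_0_iff finite_forests)
  then have "card (forests (darts E ends) (other ends) B (insert v U))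
      \<le> card (forests (darts E ends) (other ends) {v} U)
        * card (forests (darts E ends) (other ends) B ({v} \<union> U))"
    by simp
  also have "\<dots> \<le> card (forests (darts E ends) (other ends) ({v} \<union> B) U)"
    using B finite_darts[OF G] by (intro card_forests_Un) auto
  finally show ?thesis by simp
qed

section \<open>The lower bound for forests in a transitive graph\<close>

lemma automorphism_embedding: "automorphism V E ends \<sigma> \<pi> \<Longrightarrow> embedding V E ends V E ends \<sigma> \<pi>"
  by (auto simp: automorphism_def embedding_def bij_betw_def)

text \<open>Among the violators of \<open>ln (N A) \<ge> (|A| / |V|) ln \<tau>\<close> that minimize the difference of both
  sides, take one with fewest vertices. A translate of it that misses a boundary vertex \<open>b \<in> A\<close>
  yields, by submodularity, a violator at least as bad inside \<open>A - {b}\<close>. If the two sets cover \<open>V\<close>,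
  submodularity is applied with \<open>A - {b}\<close> in place of \<open>A\<close>, which costs nothing because \<open>b\<close> has an
  edge leaving \<open>A\<close>.\<close>
lemma transitive_forests_bound:
  assumes conn: "connected_multigraph V E ends" and trans: "vertex_transitive V E ends"
    and \<tau>: "0 < num_spanning_trees V E ends" and A0: "A0 \<subset> V"
  shows "real (num_spanning_trees V E ends) powr (real (card A0) / real (card V))
    \<le> real (card (forests (darts E ends) (other ends) A0 (V - A0)))"
proof -
  have G: "multigraph V E ends" and cV: "connected_via V E ends"
    using conn by (auto simp: connected_multigraph_def)
  have V: "finite V" "V \<noteq> {}" using G cV by (auto simp: multigraph_def connected_via_def)
  let ?N = "nforests (darts E ends) (other ends)"
  note fd = finite_darts[OF G]
  define t where "t = real (num_spanning_trees V E ends)"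
  define n where "n = real (card V)"
  have t0: "0 < t" using \<tau> by (simp add: t_def)
  have n0: "0 < n" using V by (simp add: n_def card_gt_0_iff)
  have N: "?N A = real (card (forests (darts E ends) (other ends) A (V - A)))" if "A \<subseteq> V" for A
    using that by (simp add: nforests_def forests_target[OF G])
  have N_tree: "?N (V - {z}) = t" if "z \<in> V" for z
    using card_forests_tree[OF G that] that by (simp add: N t_def double_diff)
  have N_pos: "0 < ?N A" if A: "A \<subset> V" for A
  proof -
    obtain z where "z \<in> V" "z \<notin> A" using A by blast
    then have *: "0 < ?N (V - {z})" "A \<subseteq> V - {z}" using A t0 by (auto simp: N_tree)
    show ?thesis
      by (rule nforests_pos_subset[where D = "darts E ends", OF fd *(1) _ *(2)]) (use V in simp)
  qed
  have ln_le: "ln a + ln b \<le> ln c + ln d" if "a * b \<le> c * d" "0 < a" "0 < b" "0 < c" "0 < d"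
    for a b c d :: real
    using that ln_mono[of "a * b" "c * d"] by (simp add: ln_mult)
  \<comment> \<open>The surplus over the desired bound on a logarithmic scale. The subtracted term
    is modular, so submodularity carries over.\<close>
  define \<kappa> where "\<kappa> A = ln (?N A) - real (card A) * (ln t / n)" for A
  have \<kappa>_submodular: "\<kappa> (A \<union> B) + \<kappa> (A \<inter> B) \<le> \<kappa> A + \<kappa> B" if "A \<union> B \<subset> V" for A B
  proof -
    have fin: "finite A" "finite B" using that V by (auto intro: finite_subset)
    have "?N (A \<union> B) * ?N (A \<inter> B) \<le> ?N A * ?N B"
      by (rule nforests_submodular[OF fd fin])
    then have "ln (?N (A \<union> B)) + ln (?N (A \<inter> B)) \<le> ln (?N A) + ln (?N B)"
      by (rule ln_le) (use that in \<open>auto intro!: N_pos\<close>)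
    moreover have "real (card A) + real (card B) = real (card (A \<union> B)) + real (card (A \<inter> B))"
      using card_Un_Int[OF fin] by linarith
    then have "real (card A) * (ln t / n) + real (card B) * (ln t / n)
        = real (card (A \<union> B)) * (ln t / n) + real (card (A \<inter> B)) * (ln t / n)"
      by (metis distrib_right)
    ultimately show ?thesis unfolding \<kappa>_def by linarith
  qed
  have "0 \<le> \<kappa> A0"
  proof (rule ccontr)
    assume neg: "\<not> 0 \<le> \<kappa> A0"
    define S where "S = {A. A \<subset> V}"
    have S: "finite S" "A0 \<in> S" using V A0 by (auto simp: S_def intro: finite_subset[of _ "Pow V"])
    define m where "m = Min (\<kappa> ` S)"
    have m: "m \<le> \<kappa> A" if "A \<subset> V" for A unfolding m_def using S that by (auto simp: S_def)
    have "m \<in> \<kappa> ` S" unfolding m_def by (rule Min_in) (use S in auto)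
    then obtain A1 where A1: "A1 \<in> S \<and> \<kappa> A1 = m" by blast
    obtain A where A: "A \<subset> V" "\<kappa> A = m"
      and least: "\<And>B. B \<subset> V \<Longrightarrow> \<kappa> B = m \<Longrightarrow> card A \<le> card B"
      using ex_has_least_nat[of "\<lambda>A. A \<in> S \<and> \<kappa> A = m", OF A1, of card] by (auto simp: S_def)
    have m0: "m < 0" using m[OF A0] neg by linarith
    have "\<kappa> {} = 0" by (simp add: \<kappa>_def nforests_def forests_def)
    then have "A \<noteq> {}" using A m0 by auto
    then obtain e b u where e: "e \<in> E" "ends e = {b, u}" and b: "b \<in> A" and u: "u \<in> V" "u \<notin> A"
      using boundary_edge[OF G cV, of "V - A"] A by blast
    obtain \<sigma> \<pi> where \<sigma>: "automorphism V E ends \<sigma> \<pi>" "\<sigma> b = u"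
      using trans b u A unfolding vertex_transitive_def by blast
    \<comment> \<open>The translate of \<open>A\<close>, taken as a preimage: it misses
      \<open>b\<close> because \<open>\<sigma> b = u\<close> lies outside \<open>A\<close>.\<close>
    define B where "B = {v \<in> V. \<sigma> v \<in> A}"
    have B: "B \<subset> V" "b \<notin> B" using \<sigma> b u A by (auto simp: B_def)
    have inj: "inj_on \<sigma> V" and surj: "\<sigma> ` V = V" using \<sigma>
      by (auto simp: automorphism_def bij_betw_def)
    have "\<sigma> ` B = \<sigma> ` V \<inter> A" "\<sigma> ` (V - B) = \<sigma> ` V - A" by (auto simp: B_def)
    then have img: "\<sigma> ` B = A" "\<sigma> ` (V - B) = V - A" using surj A by auto
    have "inj_on \<sigma> B" using inj B by (auto intro: inj_on_subset)
    then have cardB: "card B = card A" using card_image img(1) by metis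
    have "?N B \<le> ?N A"
      using card_forests_embedding[OF automorphism_embedding[OF \<sigma>(1)] G G, of B "V - B"] A B
      by (simp add: N img)
    then have "\<kappa> B \<le> \<kappa> A"
      using N_pos[OF B(1)] N_pos[OF A(1)] by (simp add: \<kappa>_def cardB)
    then have \<kappa>B: "\<kappa> B \<le> m" using A by simp
    have fin: "finite A" "finite B" using A B V by (auto intro: finite_subset)
    have "card (A \<inter> B) < card A" using b B fin by (intro psubset_card_mono) auto
    then have less: "m < \<kappa> (A \<inter> B)"
      using m[of "A \<inter> B"] least[of "A \<inter> B"] A by fastforce
    show False
    proof (cases "A \<union> B = V")
      case False
      then have "A \<union> B \<subset> V" using A B by blast
      then show False using \<kappa>_submodular[of A B] m[of "A \<union> B"] less A \<kappa>B by linarith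
    next
      case True
      let ?C = "A - {b}"
      have sets: "?C \<union> B = V - {b}" "?C \<inter> B = A \<inter> B" using True B by auto
      have "V - {b} \<subset> V" using b A by blast
      then have "\<kappa> (V - {b}) + \<kappa> (A \<inter> B) \<le> \<kappa> ?C + \<kappa> B" using \<kappa>_submodular[of ?C B] sets by simp
      \<comment> \<open>The count is \<open>t\<close> but the set has only \<open>n - 1\<close>
        vertices, which leaves a surplus of \<open>ln t / n\<close>. It cancels the cost of removing
        \<open>b\<close> from \<open>A\<close>, so that
        \<open>\<kappa> (A \<inter> B) \<le> 2 * m < m\<close>.\<close>
      moreover have "\<kappa> (V - {b}) = ln t / n"
      proof -
        have bV: "b \<in> V" using b A by blast
        then have cb: "real (card (V - {b})) = n - 1"
          unfolding n_def using card_Suc_Diff1[OF V(1)] by (metis add_diff_cancel_left' of_nat_Suc)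
        show ?thesis
          unfolding \<kappa>_def N_tree[OF bV] cb using n0 by (simp add: field_simps)
      qed
      moreover have "\<kappa> ?C \<le> \<kappa> A + ln t / n"
      proof -
        have "insert b (V - A) = V - ?C" using b A by blast
        then have "?N ?C \<le> ?N A"
          using card_forests_insert_boundary[OF G, of ?C b e u "V - A"] e b u A fin
          by (simp add: N insert_absorb subset_insertI2 subset_iff psubset_eq)
        moreover have "0 < ?N ?C" using A by (intro N_pos) auto
        ultimately have "ln (?N ?C) \<le> ln (?N A)" by simp
        moreover have "real (card ?C) = real (card A) - 1"
          using card_Suc_Diff1[OF fin(1) b] by linarith
        ultimately show ?thesis by (simp add: \<kappa>_def left_diff_distrib diff_divide_distrib)
      qed
      ultimately show False using A \<kappa>B less m0 by linarith
    qed
  qed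
  then have "real (card A0) / n * ln t \<le> ln (?N A0)" by (simp add: \<kappa>_def)
  then have "t powr (real (card A0) / n) \<le> ?N A0"
    using t0 N_pos[OF A0] by (simp add: powr_def ln_ge_iff)
  then show ?thesis using A0 by (simp add: N t_def n_def)
qed

section \<open>Growing a tree of \<open>G\<close> from copies of \<open>H\<close>\<close>

lemma num_spanning_trees_powr_le:
  assumes connG: "connected_multigraph VG EG endsG" and connH: "connected_multigraph VH EH endsH"
    and trans: "vertex_transitive VH EH endsH" and \<tau>: "0 < num_spanning_trees VH EH endsH"
    and cover: "\<And>x. x \<in> VG \<Longrightarrow> \<exists>f g y. embedding VH EH endsH VG EG endsG f g \<and> y \<in> VH \<and> f y = x"
  shows "real (num_spanning_trees VH EH endsH) powr (real (card VG) / real (card VH))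
    \<le> real (num_spanning_trees VG EG endsG)"
proof -
  have G: "multigraph VG EG endsG" and cG: "connected_via VG EG endsG"
    and H: "multigraph VH EH endsH" and cH: "connected_via VH EH endsH"
    using connG connH by (auto simp: connected_multigraph_def)
  have fin: "finite VG" "finite VH" and "VG \<noteq> {}" "VH \<noteq> {}"
    using G H cG cH by (auto simp: multigraph_def connected_via_def)
  then obtain z where z: "z \<in> VG" by blast
  let ?F = "forests (darts EG endsG) (other endsG)"
  let ?FH = "forests (darts EH endsH) (other endsH)"
  define t where "t = real (num_spanning_trees VH EH endsH)"
  define n where "n = real (card VH)"
  have t0: "0 < t" using \<tau> by (simp add: t_def)
  have n0: "0 < n" using fin \<open>VH \<noteq> {}\<close> by (simp add: n_def card_gt_0_iff)
  have card_f: "card (f ` A) = card A"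
    if "embedding VH EH endsH VG EG endsG f g" "A \<subseteq> VH" for f g A
    using that by (auto simp: embedding_def intro: card_image inj_on_subset)
  have copy: "real (card (?FH A S)) \<le> real (card (?F (f ` A) U))"
    if "embedding VH EH endsH VG EG endsG f g" "A \<subseteq> VH" "f ` S \<subseteq> U" for f g A S U
  proof -
    have "finite (f ` A)" using that fin by (auto intro: finite_subset)
    then have "card (?F (f ` A) (f ` S)) \<le> card (?F (f ` A) U)"
      by (intro card_mono forests_mono finite_forests finite_darts[OF G] that(3))
    then show ?thesis using card_forests_embedding[OF that(1) H G that(2), of S] by linarith
  qed
  have FH_tree: "real (card (?FH (VH - {y}) {y})) = t" if "y \<in> VH" for y
    using card_forests_tree[OF H that] by (simp add: t_def)
  \<comment> \<open>The exponent uses \<open>card U\<close> although the root \<open>z\<close> makes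
    no choice: the first copy of \<open>H\<close> already yields the full factor \<open>t\<close>
    for its \<open>n\<close> vertices.\<close>
  define P where "P U \<longleftrightarrow> z \<in> U \<and> U \<subseteq> VG \<and>
      t powr (real (card U) / n) \<le> real (card (?F (U - {z}) {z}))" for U
  have grow: "P (U \<union> B)" if U: "P U" and B: "B \<subseteq> VG" "U \<inter> B = {}"
    and c: "t powr (real (card B) / n) \<le> real (card (?F B U))" for U B
  proof -
    have fUB: "finite U" "finite B" using U B fin by (auto simp: P_def intro: finite_subset)
    have zU: "z \<in> U" using U by (simp add: P_def)
    have "t powr (real (card (U \<union> B)) / n) = t powr (real (card U) / n) * t powr (real (card B) / n)"
      using fUB B by (simp add: card_Un_disjoint add_divide_distrib powr_add)
    also have "\<dots> \<le> real (card (?F (U - {z}) {z})) * real (card (?F B U))"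
      using U c by (intro mult_mono) (auto simp: P_def)
    also have "\<dots> \<le> real (card (?F ((U - {z}) \<union> B) {z}))"
    proof -
      have "(U - {z}) \<union> {z} = U" using zU by blast
      then show ?thesis
        using card_forests_Un[of "U - {z}" B "darts EG endsG" "other endsG" "{z}"] fUB B
          finite_darts[OF G] by (simp flip: of_nat_mult) blast
    qed
    also have "(U - {z}) \<union> B = (U \<union> B) - {z}" using zU B by blast
    finally show ?thesis using U B by (auto simp: P_def)
  qed
  obtain f g y where f: "embedding VH EH endsH VG EG endsG f g" and y: "y \<in> VH" "f y = z"
    using cover[OF z] by blast
  have "P (f ` VH)"
  proof -
    have "f ` (VH - {y}) = f ` VH - {z}"
      using f y by (auto simp: embedding_def inj_on_def)
    then have "t \<le> real (card (?F (f ` VH - {z}) {z}))"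
      using copy[OF f, of "VH - {y}" "{y}" "{z}"] y FH_tree[OF y(1)] by auto
    then show ?thesis
      using f y card_f[OF f order_refl] n0 t0 by (auto simp: P_def embedding_def n_def)
  qed
  moreover have "\<forall>U. P U \<longrightarrow> card U < Suc (card VG)"
    using fin by (auto simp: P_def card_mono less_Suc_eq_le)
  ultimately have "\<exists>U. P U \<and> (\<forall>W. P W \<longrightarrow> card W \<le> card U)"
    by (rule Lattices_Big.ex_has_greatest_nat)
  then obtain U where U: "P U" and max: "\<And>W. P W \<Longrightarrow> card W \<le> card U"
    by blast
  have UV: "U \<subseteq> VG" "z \<in> U" using U by (auto simp: P_def)
  have fU: "finite U" using UV fin by (auto intro: finite_subset)
  have "U = VG"
  proof (rule ccontr)
    assume "U \<noteq> VG"
    then obtain e v u where e: "e \<in> EG" "endsG e = {v, u}" and v: "v \<in> VG" "v \<notin> U" and u: "u \<in> U"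
      using boundary_edge[OF G cG UV(1)] UV by blast
    obtain f g y where f: "embedding VH EH endsH VG EG endsG f g" and y: "y \<in> VH" "f y = v"
      using cover[OF v(1)] by blast
    have fV: "f ` VH \<subseteq> VG" using f by (simp add: embedding_def)
    \<comment> \<open>The part of the copy still to be attached; the rest of the copy lies in
      \<open>U\<close> and provides the roots.\<close>
    define A where "A = {x \<in> VH. f x \<notin> U}"
    have A: "A \<subseteq> VH" "y \<in> A" using y v by (auto simp: A_def)
    show False
    proof (cases "A = VH")
      case False
      have "t powr (real (card A) / n) \<le> real (card (?FH A (VH - A)))"
        unfolding t_def n_def using False A
        by (intro transitive_forests_bound[OF connH trans \<tau>]) auto
      also have "\<dots> \<le> real (card (?F (f ` A) U))"
        by (rule copy[OF f A(1)]) (auto simp: A_def)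
      finally have "P (U \<union> f ` A)"
        using A fV card_f[OF f A(1)] by (intro grow[OF U]) (auto simp: A_def)
      then have "card (U \<union> f ` A) \<le> card U" by (rule max)
      moreover have "U \<subset> U \<union> f ` A" using A y v by blast
      then have "card U < card (U \<union> f ` A)"
        using fU A fin by (intro psubset_card_mono) (auto intro: finite_subset)
      ultimately show False by simp
    next
      \<comment> \<open>The copy is disjoint from \<open>U\<close>, so the bound for proper subsets
        does not apply. Instead, spanning trees of the copy rooted at \<open>v\<close> are joined to
        \<open>U\<close> by the edge \<open>e\<close>.\<close>
      case True
      let ?B = "f ` (VH - {y})"
      have inj: "inj_on f VH" using f by (simp add: embedding_def)
      have vB: "v \<notin> ?B" using inj y by (auto simp: inj_on_def)
      have fB: "insert v ?B = f ` VH" using y by blast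
      have "t powr (real (card (f ` VH)) / n) = t"
        using card_f[OF f order_refl] n0 t0 by (simp add: n_def)
      also have "t \<le> real (card (?F ?B (insert v U)))"
        using copy[OF f, of "VH - {y}" "{y}" "insert v U"] FH_tree[OF y(1)] y by auto
      also have "\<dots> \<le> real (card (?F (insert v ?B) U))"
        using card_forests_insert_boundary[OF G _ vB e v(2) u] fin by simp
      finally have "P (U \<union> f ` VH)"
        unfolding fB using True fV by (intro grow[OF U]) (auto simp: A_def)
      then have "card (U \<union> f ` VH) \<le> card U" by (rule max)
      moreover have "U \<subset> U \<union> f ` VH" using y v by blast
      then have "card U < card (U \<union> f ` VH)"
        using fU fin by (intro psubset_card_mono) auto
      ultimately show False by simp
    qed
  qed
  then show ?thesis
    using U card_forests_tree[OF G z] by (simp add: P_def t_def n_def)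
qed

section \<open>From domination to the inequality\<close>

text \<open>The first marginal has all of \<open>VG\<close> as its support, so some pair
  \<open>(x, y)\<close> has positive probability; the second marginal places \<open>y\<close> in
  \<open>VH\<close>.\<close>

lemma dominates_cover:
  fixes VG :: "'a set" and VH :: "'b set"
  assumes dom: "dominates VG EG endsG VH EH endsH" and fin: "finite VG" "finite VH" "VH \<noteq> {}"
    and x: "x \<in> VG"
  shows "\<exists>f g y. embedding VH EH endsH VG EG endsG f g \<and> y \<in> VH \<and> f y = x"
proof -
  obtain p :: "('a \<times> 'b) pmf" where p: "map_pmf fst p = pmf_of_set VG" "map_pmf snd p = pmf_of_set VH"
    and emb: "\<forall>(x, y)\<in>set_pmf p. \<exists>f g. embedding VH EH endsH VG EG endsG f g \<and> f y = x"
    using dom unfolding dominates_def by blast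
  have "VG \<noteq> {}" using x by blast
  then have "fst ` set_pmf p = VG" using p fin by (metis set_map_pmf set_pmf_of_set)
  then obtain y where y: "(x, y) \<in> set_pmf p" using x by force
  have "snd ` set_pmf p = VH" using p fin by (metis set_map_pmf set_pmf_of_set)
  then have "y \<in> VH" using y by force
  then show ?thesis using emb y by blast
qed

theorem theorem3p4:
  fixes VG :: "'a set" and EG :: "'e set" and endsG :: "'e \<Rightarrow> 'a set"
    and VH :: "'b set" and EH :: "'f set" and endsH :: "'f \<Rightarrow> 'b set"
  assumes "connected_multigraph VG EG endsG"
    and "connected_multigraph VH EH endsH"
    and "vertex_transitive VH EH endsH"
    and "dominates VG EG endsG VH EH endsH"
  shows "real (num_spanning_trees VG EG endsG) powr (1 / real (card VG))
         \<ge> real (num_spanning_trees VH EH endsH) powr (1 / real (card VH))"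
proof (cases "num_spanning_trees VH EH endsH = 0")
  case False
  let ?tG = "real (num_spanning_trees VG EG endsG)" and ?tH = "real (num_spanning_trees VH EH endsH)"
  have fin: "finite VG" "finite VH" "VG \<noteq> {}" "VH \<noteq> {}"
    using assms(1,2) by (auto simp: connected_multigraph_def multigraph_def connected_via_def)
  have "?tH powr (real (card VG) / real (card VH)) \<le> ?tG"
    using False dominates_cover[OF assms(4)] fin
    by (intro num_spanning_trees_powr_le assms(1-3)) auto
  then have "(?tH powr (real (card VG) / real (card VH))) powr (1 / real (card VG))
      \<le> ?tG powr (1 / real (card VG))"
    by (intro powr_mono2) auto
  then show ?thesis using fin by (simp add: powr_powr)
\<comment> \<open>If the count for \<open>H\<close> is zero, the smaller side is
  \<open>0 powr _\<close>, which equals \<open>0\<close>. The existence of a spanning tree thus need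
  not be proved.\<close>
qed simp

end
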